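(* Let $(R,\oplus,\otimes)=(\mathbb{R},+,\times)$ and let all costs $c_\alpha$, $\alpha\in\Pi^\circ$, be strictly positive. Assume $D\subseteq\Gamma$, and let $\Pi$ be the set of prefixes of patterns in $\Pi^\circ$ together with all empty patterns $\varepsilon_s$, $s\in[0,n]$. Consider the following randomized algorithm. 1. Compute $M_s(\alpha)=\sum_{x\in\mathcal{X}_s(\alpha;\Pi_s)}f(x)$ for all $s\in[0,n]$ and $\alpha\in\Pi_s$. 2. Sample $\alpha_n\in\Pi_n$ with probability $p(\alpha_n)\propto M_n(\alpha_n)$. 3. For $s=n-1,\ldots,1$ sample $\alpha_s\in\Delta_s(\alpha_{s+1})$ with probability $p(\alpha_s)\propto M_s(\alpha_s)$. 4. Return the labeling $x\in D^{1:n}$ with $x_{s:s}=(\alpha_s)_{s:s}$ for $s\in[1,n]$. Say (recursively) that step $s$ is valid if either $s=n$, or $s\in[1,n-1]$, step $s+1$ is valid, $\alpha_{s+1}\neq\varepsilon_{s+1}$, and $M_s(\alpha)>0$ for some $\alpha\in\Delta_s(\alpha_{s+1})$. Then: (a) with probability $1$ all steps $s\in[1,n]$ of the algorithm are valid; (b) the returned labeling $x\in D^{1:n}$ is distributed according to $p(x)=f(x)/Z$, where $Z=\sum_{x\in D^{1:n}}f(x)$.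
   Context: $D$ is a finite alphabet, $n\ge1$, and $\Gamma$ is a finite set of non-empty words over $D$ (letters are identified with words of length one). A pattern is a pair $\alpha=([i,j],w)$ where $[i,j]$ is an integer interval in $[1,n]$, possibly empty ($j\ge i-1$), and $w=w_i\ldots w_j$ is a word over $D$ of length $|\alpha|=j-i+1$. For $s\in[0,n]$, $\varepsilon_s=([s+1,s],\varepsilon)$ is the empty pattern at $s$. The concatenation of $([i,j],w)$ and $([j+1,k],v)$ is $([i,k],wv)$. The symbol $\ast$ denotes an arbitrary possibly empty pattern and $+$ an arbitrary non-empty pattern; e.g. $x=\ast\alpha\ast$ means that $\alpha$ is a subpattern of $x$ (at its own position), $x=\ast\alpha$ that $\alpha$ is a suffix of $x$. For $\alpha=([i,j],w)$ and $[k,\ell]\subseteq[i,j]$, $\alpha_{k:\ell}=([k,\ell],w_k\ldots w_\ell)$. $D^{i:j}$ is the set of patterns with interval $[i,j]$. For non-empty $\alpha$, $\alpha^-$ is its prefix of length $|\alpha|-1$. $\Pi^\circ=\{([i,j],\alpha)\mid\alpha\in\Gamma,\ [i,j]\subseteq[1,n],\ j-i+1=|\alpha|\}$. $\Pi_s$ is the set of patterns in $\Pi$ ending at position $s$. $G[\Pi_s]=(\Pi_s,E[\Pi_s])$ is the Hasse diagram of $\Pi_s$ under the order "$\alpha\preceq\beta$ iff $\alpha$ is a suffix of $\beta$", with $(\alpha,\beta)\in E[\Pi_s]$ iff $\alpha\prec\beta$ and no $\gamma\in\Pi_s$ satisfies $\alpha\prec\gamma\prec\beta$; it is a tree rooted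 at $\varepsilon_s$. The cost of a pattern $x$ is $f(x)=\prod_{\alpha\in\Pi^\circ,\,x=\ast\alpha\ast}c_\alpha$ (empty product $=1$). $\mathcal{X}_s(\alpha)=\{x\in D^{1:s}\mid x=\ast\alpha\}$ and $\mathcal{X}_s(\alpha;\Pi_s)=\{x\in\mathcal{X}_s(\alpha)\mid x\ne\ast\beta\text{ for all }\beta\in\Pi_s\text{ of the form }\beta=+\alpha\}$. $T_s(\alpha)$ for $\alpha\in\Pi_s$ is the set of nodes of the subtree of $G[\Pi_s]$ rooted at $\alpha$ (including $\alpha$). For $\alpha\in\Pi_{s+1}-\{\varepsilon_{s+1}\}$, $$\Delta_s(\alpha)=T_s(\alpha^-)-\bigcup_{(\alpha,\beta)\in E[\Pi_{s+1}]}T_s(\beta^-).$$ *)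

theory Defs
  imports "HOL-Probability.Probability"
begin

text \<open>
  The pattern \<open>([i,j], w)\<close> is the pair \<open>((i, j), w)\<close>. An empty pattern still carries its position, so
  \<open>((s + 1, s), [])\<close> differs for different \<open>s\<close>.
\<close>

type_synonym 'd pattern = "(nat \<times> nat) \<times> 'd list"

definition pat_start :: "'d pattern \<Rightarrow> nat" where
  "pat_start \<alpha> = fst (fst \<alpha>)"

definition pat_end :: "'d pattern \<Rightarrow> nat" where
  "pat_end \<alpha> = snd (fst \<alpha>)"

definition word :: "'d pattern \<Rightarrow> 'd list" where
  "word \<alpha> = snd \<alpha>"

definition empty_pat :: "nat \<Rightarrow> 'd pattern" where
  "empty_pat s = ((s + 1, s), [])"

text \<open>Concatenation and restriction are meaningful only under \<open>adjacent \<alpha> \<beta>\<close> and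
  \<open>[k,l] \<subseteq> [pat_start \<alpha>, pat_end \<alpha>]\<close> respectively; removing the last letter requires a non-empty
  pattern.\<close>

definition adjacent :: "'d pattern \<Rightarrow> 'd pattern \<Rightarrow> bool" where
  "adjacent \<alpha> \<beta> \<longleftrightarrow> pat_start \<beta> = pat_end \<alpha> + 1"

definition pat_concat :: "'d pattern \<Rightarrow> 'd pattern \<Rightarrow> 'd pattern" where
  "pat_concat \<alpha> \<beta> = ((pat_start \<alpha>, pat_end \<beta>), word \<alpha> @ word \<beta>)"

definition pat_restrict :: "nat \<Rightarrow> nat \<Rightarrow> 'd pattern \<Rightarrow> 'd pattern" where
  "pat_restrict k l \<alpha> = ((k, l), take (l + 1 - k) (drop (k - pat_start \<alpha>) (word \<alpha>)))"

definition pat_minus :: "'d pattern \<Rightarrow> 'd pattern" where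
  "pat_minus \<alpha> = ((pat_start \<alpha>, pat_end \<alpha> - 1), butlast (word \<alpha>))"

text \<open>
  A random element of \<open>A\<close> with probability proportional to \<open>w\<close>, or \<open>None\<close> if \<open>w\<close> cannot be
  normalized on \<open>A\<close>.
\<close>

definition sample_prop :: "'a set \<Rightarrow> ('a \<Rightarrow> real) \<Rightarrow> 'a option pmf" where
  "sample_prop A w =
     (if finite A \<and> (\<forall>a\<in>A. 0 \<le> w a) \<and> (\<exists>a\<in>A. 0 < w a)
      then map_pmf Some (embed_pmf (\<lambda>a. if a \<in> A then w a / (\<Sum>b\<in>A. w b) else 0))
      else return_pmf None)"

context
  fixes n :: nat
    and D :: "'d set"
    and \<Gamma> :: "'d list set"
    and c :: "'d pattern \<Rightarrow> real"
begin

definition labelings :: "nat \<Rightarrow> nat \<Rightarrow> 'd pattern set" where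
  "labelings i j = {((i, j), w) | w. w \<in> lists D \<and> length w = j + 1 - i}"

definition patterns :: "'d pattern set" where
  "patterns = (\<Union>{labelings i j | i j. 1 \<le> i \<and> i \<le> j + 1 \<and> j \<le> n})"

text \<open>\<open>x = *\<alpha>*\<close>, \<open>x = \<alpha>*\<close>, \<open>x = *\<alpha>\<close> and \<open>x = +\<alpha>\<close>, in this order.\<close>

definition is_subpattern :: "'d pattern \<Rightarrow> 'd pattern \<Rightarrow> bool" where
  "is_subpattern \<alpha> x \<longleftrightarrow>
     (\<exists>\<beta>\<in>patterns. \<exists>\<gamma>\<in>patterns. adjacent \<beta> \<alpha> \<and> adjacent \<alpha> \<gamma> \<and>
        x = pat_concat (pat_concat \<beta> \<alpha>) \<gamma>)"

definition is_prefix :: "'d pattern \<Rightarrow> 'd pattern \<Rightarrow> bool" where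
  "is_prefix \<alpha> x \<longleftrightarrow> (\<exists>\<gamma>\<in>patterns. adjacent \<alpha> \<gamma> \<and> x = pat_concat \<alpha> \<gamma>)"

definition is_suffix :: "'d pattern \<Rightarrow> 'd pattern \<Rightarrow> bool" where
  "is_suffix \<alpha> x \<longleftrightarrow> (\<exists>\<beta>\<in>patterns. adjacent \<beta> \<alpha> \<and> x = pat_concat \<beta> \<alpha>)"

definition is_proper_suffix :: "'d pattern \<Rightarrow> 'd pattern \<Rightarrow> bool" where
  "is_proper_suffix \<alpha> x \<longleftrightarrow>
     (\<exists>\<beta>\<in>patterns. word \<beta> \<noteq> [] \<and> adjacent \<beta> \<alpha> \<and> x = pat_concat \<beta> \<alpha>)"

definition Pi_circ :: "'d pattern set" where
  "Pi_circ = {((i, j), w) | i j w. w \<in> \<Gamma> \<and> 1 \<le> i \<and> j \<le> n \<and> j + 1 = i + length w}"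

definition Pi_all :: "'d pattern set" where
  "Pi_all = {\<alpha> \<in> patterns. \<exists>\<beta>\<in>Pi_circ. is_prefix \<alpha> \<beta>} \<union> {empty_pat s | s. s \<le> n}"

definition Pi_at :: "nat \<Rightarrow> 'd pattern set" where
  "Pi_at s = {\<alpha> \<in> Pi_all. pat_end \<alpha> = s}"

definition cost :: "'d pattern \<Rightarrow> real" where
  "cost x = (\<Prod>\<alpha>\<in>{\<alpha> \<in> Pi_circ. is_subpattern \<alpha> x}. c \<alpha>)"

definition partition_function :: real where
  "partition_function = (\<Sum>x\<in>labelings 1 n. cost x)"

definition X :: "nat \<Rightarrow> 'd pattern \<Rightarrow> 'd pattern set" where
  "X s \<alpha> = {x \<in> labelings 1 s. is_suffix \<alpha> x}"

definition X_excl :: "nat \<Rightarrow> 'd pattern \<Rightarrow> 'd pattern set \<Rightarrow> 'd pattern set" where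
  "X_excl s \<alpha> P = {x \<in> X s \<alpha>. \<forall>\<beta>\<in>P. is_proper_suffix \<alpha> \<beta> \<longrightarrow> \<not> is_suffix \<beta> x}"

definition M :: "nat \<Rightarrow> 'd pattern \<Rightarrow> real" where
  "M s \<alpha> = (\<Sum>x\<in>X_excl s \<alpha> (Pi_at s). cost x)"

definition suffix_less :: "'d pattern \<Rightarrow> 'd pattern \<Rightarrow> bool" where
  "suffix_less \<alpha> \<beta> \<longleftrightarrow> is_suffix \<alpha> \<beta> \<and> \<alpha> \<noteq> \<beta>"

definition E :: "'d pattern set \<Rightarrow> ('d pattern \<times> 'd pattern) set" where
  "E P = {(\<alpha>, \<beta>). \<alpha> \<in> P \<and> \<beta> \<in> P \<and> suffix_less \<alpha> \<beta> \<and>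
            \<not> (\<exists>\<gamma>\<in>P. suffix_less \<alpha> \<gamma> \<and> suffix_less \<gamma> \<beta>)}"

definition T :: "nat \<Rightarrow> 'd pattern \<Rightarrow> 'd pattern set" where
  "T s \<alpha> = (E (Pi_at s))\<^sup>* `` {\<alpha>}"

definition \<Delta> :: "nat \<Rightarrow> 'd pattern \<Rightarrow> 'd pattern set" where
  "\<Delta> s \<alpha> = T s (pat_minus \<alpha>) - (\<Union>\<beta>\<in>{\<beta>. (\<alpha>, \<beta>) \<in> E (Pi_at (s + 1))}. T s (pat_minus \<beta>))"

text \<open>
  A run maps \<open>s\<close> to the sampled \<open>\<alpha>\<^sub>s\<close>, and to \<open>None\<close> if the algorithm got stuck before sampling
  \<open>\<alpha>\<^sub>s\<close>: \<open>\<Delta> s \<alpha>\<close> is undefined for \<open>\<alpha> = empty_pat (s + 1)\<close>, or all weights vanish.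
\<close>

definition sample_step :: "nat \<Rightarrow> (nat \<rightharpoonup> 'd pattern) \<Rightarrow> (nat \<rightharpoonup> 'd pattern) pmf" where
  "sample_step s a = map_pmf (\<lambda>r. a(s := r))
     (case a (s + 1) of
        None \<Rightarrow> return_pmf None
      | Some \<alpha> \<Rightarrow> if \<alpha> = empty_pat (s + 1) then return_pmf None else sample_prop (\<Delta> s \<alpha>) (M s))"

definition run :: "(nat \<rightharpoonup> 'd pattern) pmf" where
  "run = fold (\<lambda>s p. bind_pmf p (sample_step s)) (rev [1..<n])
           (map_pmf (\<lambda>r. Map.empty(n := r)) (sample_prop (Pi_at n) (M n)))"

inductive valid_step :: "(nat \<rightharpoonup> 'd pattern) \<Rightarrow> nat \<Rightarrow> bool" for a where
  last: "valid_step a n"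
| step: "\<lbrakk>1 \<le> s; s < n; valid_step a (s + 1); a (s + 1) = Some \<alpha>; \<alpha> \<noteq> empty_pat (s + 1);
          \<exists>\<beta>\<in>\<Delta> s \<alpha>. M s \<beta> > 0\<rbrakk> \<Longrightarrow> valid_step a s"

text \<open>No labeling is returned if some \<open>\<alpha>\<^sub>s\<close> was not sampled or has no letter at position \<open>s\<close>.\<close>

definition labeling_of :: "(nat \<rightharpoonup> 'd pattern) \<Rightarrow> 'd pattern option" where
  "labeling_of a =
     (if \<forall>s\<in>{1..n}. \<exists>\<alpha>. a s = Some \<alpha> \<and> \<alpha> \<noteq> empty_pat s
      then Some ((1, n), concat (map (\<lambda>s. word (pat_restrict s s (the (a s)))) [1..<n + 1]))
      else None)"

definition returned :: "'d pattern option pmf" where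
  "returned = map_pmf labeling_of run"

end

end

theory Submission
  imports Defs "HOL-Library.Sublist"
begin

text \<open>
  Every labeling \<open>x\<close> determines the run in which \<open>\<alpha>\<^sub>s\<close> is the longest suffix of \<open>x\<^bsub>1:s\<^esub>\<close>
  lying in \<open>\<Pi>\<^sub>s\<close>; it is never empty because \<open>D \<subseteq> \<Gamma>\<close>. The words \<open>y\<close> whose longest suffix lies in
  \<open>\<Delta>\<^sub>s(\<alpha>)\<close> are exactly those whose extension by the last letter of \<open>\<alpha>\<close> has longest suffix \<open>\<alpha>\<close>, and
  this extension multiplies the cost by a factor \<open>g(\<alpha>)\<close> depending on \<open>\<alpha>\<close> only. Hence
  \<open>M\<^bsub>s+1\<^esub>(\<alpha>)\<close> is \<open>g(\<alpha>)\<close> times the sum of \<open>M\<^sub>s\<close> over \<open>\<Delta>\<^sub>s(\<alpha>)\<close>, and the probability of the run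
  determined by \<open>x\<close> telescopes to \<open>f(x)/Z\<close>. These probabilities already sum to 1, so lower bounds
  suffice throughout and there are no other runs.
\<close>

section \<open>Longest suffixes of a word inside a set of words\<close>

text \<open>\<open>ARG_MAX\<close> is pinned down only when \<open>A\<close> contains some suffix of
  \<open>w\<close>; every use has \<open>[] \<in> A\<close>.\<close>

definition longest :: "'a list set \<Rightarrow> 'a list \<Rightarrow> 'a list" where
  "longest A w = (ARG_MAX length v. v \<in> A \<and> suffix v w)"

text \<open>The suffixes of one word form a chain, so a suffix of maximal length in \<open>A\<close>
  is also the greatest one in the suffix order.\<close>

lemma
  assumes "[] \<in> A"
  shows longest_in: "longest A w \<in> A"
    and suffix_longest: "suffix (longest A w) w"
    and longest_greatest: "\<lbrakk>v \<in> A; suffix v w\<rbrakk> \<Longrightarrow> suffix v (longest A w)"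
proof -
  have "\<forall>v. v \<in> A \<and> suffix v w \<longrightarrow> length v < Suc (length w)"
    by (auto dest: suffix_length_le)
  with assms have *: "(longest A w \<in> A \<and> suffix (longest A w) w) \<and>
      (\<forall>v. v \<in> A \<and> suffix v w \<longrightarrow> length v \<le> length (longest A w))"
    unfolding longest_def by (intro arg_max_nat_lemma[where k = "[]"]) auto
  then show "longest A w \<in> A" "suffix (longest A w) w" by auto
  show "suffix v (longest A w)" if "v \<in> A" "suffix v w"
    using * that suffix_length_suffix by blast
qed

text \<open>The right-hand side has the shape of the exclusion condition in \<open>X_excl\<close>,
  which thereby becomes a statement about \<open>longest\<close>.\<close>

lemma longest_eq_iff:
  assumes "[] \<in> A"
  shows "longest A w = v \<longleftrightarrow> v \<in> A \<and> suffix v w \<and> (\<forall>b\<in>A. strict_suffix v b \<longrightarrow> \<not> suffix b w)"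
  using longest_in[OF assms, of w] suffix_longest[OF assms, of w] longest_greatest[OF assms, of _ w]
  by (metis strict_suffix_def suffix_order.antisym)

lemma suffix_snoc_iff:
  "v \<noteq> [] \<Longrightarrow> suffix v (y @ [a]) \<longleftrightarrow> last v = a \<and> suffix (butlast v) y"
  by (metis append_butlast_last_id snoc_suffix_snoc)

section \<open>Patterns encoded by end position and word\<close>

text \<open>End position and word determine the interval, so questions about patterns become
  questions about lists. The truncated subtraction is harmless for
  \<open>length w \<le> s + 1\<close>; injectivity holds in any case.\<close>

definition pat :: "nat \<Rightarrow> 'd list \<Rightarrow> 'd pattern" where
  "pat s w = ((s + 1 - length w, s), w)"

lemma pat_eq_iff [simp]: "pat s v = pat t w \<longleftrightarrow> s = t \<and> v = w"
  by (auto simp: pat_def)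

lemma pat_start_pat [simp]: "pat_start (pat s w) = s + 1 - length w"
  and pat_end_pat [simp]: "pat_end (pat s w) = s"
  and word_pat [simp]: "word (pat s w) = w"
  by (simp_all add: pat_def pat_start_def pat_end_def word_def)

lemma empty_pat_eq: "empty_pat s = pat s []"
  by (simp add: pat_def empty_pat_def)

lemma inj_pat: "inj_on (pat s) A"
  by (simp add: inj_on_def)

lemma pat_minus_pat: "\<lbrakk>w \<noteq> []; length w \<le> s + 1\<rbrakk> \<Longrightarrow> pat_minus (pat (s + 1) w) = pat s (butlast w)"
  by (cases w rule: rev_cases) (auto simp: pat_minus_def pat_def pat_start_def pat_end_def word_def)

lemma pat_concat_pat:
  "length v + length w \<le> s \<Longrightarrow> pat_concat (pat (s - length w) v) (pat s w) = pat s (v @ w)"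
  by (auto simp: pat_concat_def pat_def pat_start_def pat_end_def word_def)

lemma adjacent_pat:
  "length w \<le> s \<Longrightarrow> adjacent (pat t v) (pat s w) \<longleftrightarrow> t = s - length w"
  by (auto simp: adjacent_def)

lemma labelings_eq: "labelings D (Suc 0) s = pat s ` {w \<in> lists D. length w = s}"
  by (auto simp: labelings_def pat_def image_iff)

lemma patterns_eq: "patterns n D = {pat s w | s w. s \<le> n \<and> length w \<le> s \<and> w \<in> lists D}"
proof (intro equalityI subsetI)
  fix \<alpha> assume "\<alpha> \<in> patterns n D"
  then obtain i j w where "\<alpha> = ((i, j), w)" "w \<in> lists D" "length w = j + 1 - i"
      "1 \<le> i" "i \<le> j + 1" "j \<le> n"
    by (auto simp: patterns_def labelings_def)
  then show "\<alpha> \<in> {pat s w | s w. s \<le> n \<and> length w \<le> s \<and> w \<in> lists D}"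
    by (auto simp: pat_def)
next
  fix \<alpha> assume "\<alpha> \<in> {pat s w | s w. s \<le> n \<and> length w \<le> s \<and> w \<in> lists D}"
  then obtain s w where *: "\<alpha> = pat s w" "s \<le> n" "length w \<le> s" "w \<in> lists D"
    by auto
  then have "\<alpha> \<in> labelings D (s + 1 - length w) s"
    by (auto simp: labelings_def pat_def)
  moreover have "1 \<le> s + 1 - length w" "s + 1 - length w \<le> s + 1"
    using * by auto
  ultimately show "\<alpha> \<in> patterns n D"
    unfolding patterns_def using \<open>s \<le> n\<close> by blast
qed

lemma pat_in_patterns: "\<lbrakk>s \<le> n; length w \<le> s; w \<in> lists D\<rbrakk> \<Longrightarrow> pat s w \<in> patterns n D"
  by (auto simp: patterns_eq)

lemma patternsE:
  assumes "\<alpha> \<in> patterns n D"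
  obtains s w where "\<alpha> = pat s w" "s \<le> n" "length w \<le> s" "w \<in> lists D"
  using assms by (auto simp: patterns_eq)

text \<open>Common core of \<open>is_suffix\<close> (\<open>Q\<close> always true) and
  \<open>is_proper_suffix\<close> (\<open>Q\<close> demands a non-empty word).\<close>

lemma ex_pat_concat_iff:
  assumes "w \<in> lists D" "length w \<le> s" "s \<le> n" "length v \<le> t"
  shows "(\<exists>\<beta>\<in>patterns n D. Q (word \<beta>) \<and> adjacent \<beta> (pat t v) \<and> pat s w = pat_concat \<beta> (pat t v))
    \<longleftrightarrow> t = s \<and> (\<exists>u. Q u \<and> w = u @ v)" (is "?l \<longleftrightarrow> ?r")
proof
  assume ?l
  then obtain \<beta> where "\<beta> \<in> patterns n D" "Q (word \<beta>)" "adjacent \<beta> (pat t v)"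
      "pat s w = pat_concat \<beta> (pat t v)" by auto
  then show ?r
    by (auto simp: pat_concat_def pat_def pat_end_def word_def)
next
  assume ?r
  then obtain u where u: "t = s" "Q u" "w = u @ v" by auto
  with assms have "pat (s - length v) u \<in> patterns n D"
    by (intro pat_in_patterns) auto
  with u assms show ?l
    by (intro bexI[of _ "pat (s - length v) u"]) (auto simp: adjacent_pat pat_concat_pat)
qed

lemma is_suffix_pat:
  assumes "w \<in> lists D" "length w \<le> s" "s \<le> n" "length v \<le> t"
  shows "is_suffix n D (pat t v) (pat s w) \<longleftrightarrow> t = s \<and> suffix v w"
  using ex_pat_concat_iff[OF assms, of "\<lambda>_. True"] by (auto simp: is_suffix_def suffix_def)

lemma is_proper_suffix_pat:
  assumes "w \<in> lists D" "length w \<le> s" "s \<le> n" "length v \<le> t"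
  shows "is_proper_suffix n D (pat t v) (pat s w) \<longleftrightarrow> t = s \<and> strict_suffix v w"
  using ex_pat_concat_iff[OF assms, of "\<lambda>u. u \<noteq> []"]
  by (auto simp: is_proper_suffix_def strict_suffix_def suffix_def)

text \<open>An occurrence ending at position \<open>t\<close> is a suffix of the first
  \<open>t\<close> letters. The hypothesis \<open>length w = s\<close> puts the first letter at
  position 1, so that positions and list prefixes agree.\<close>

lemma is_subpattern_pat:
  assumes "w \<in> lists D" "length w = s" "s \<le> n" "length v \<le> t"
  shows "is_subpattern n D (pat t v) (pat s w) \<longleftrightarrow> t \<le> s \<and> suffix v (take t w)" (is "?l \<longleftrightarrow> ?r")
proof
  assume ?l
  then obtain \<beta> \<gamma> where *: "\<beta> \<in> patterns n D" "\<gamma> \<in> patterns n D" "adjacent \<beta> (pat t v)"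
      "adjacent (pat t v) \<gamma>" "pat s w = pat_concat (pat_concat \<beta> (pat t v)) \<gamma>"
    unfolding is_subpattern_def by blast
  obtain k u where \<beta>: "\<beta> = pat k u" "length u \<le> k" using *(1) by (auto elim: patternsE)
  obtain l r where \<gamma>: "\<gamma> = pat l r" "length r \<le> l" using *(2) by (auto elim: patternsE)
  have "k = t - length v" "t = l - length r"
    using *(3,4) \<beta> \<gamma> assms by (auto simp: adjacent_pat)
  moreover have "l = s" "k + 1 - length u = 1" "w = u @ v @ r"
    using *(5) \<beta> \<gamma> assms by (auto simp: pat_concat_def pat_def pat_start_def pat_end_def word_def)
  ultimately have "length (u @ v) = t" "w = (u @ v) @ r" "t \<le> s"
    using \<beta>(2) \<gamma>(2) assms by auto
  then show ?r
    by (simp add: suffix_def)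
next
  assume r: ?r
  then obtain u where u: "take t w = u @ v" by (auto simp: suffix_def)
  let ?r = "drop t w"
  have w: "w = (u @ v) @ ?r" by (metis u append_take_drop_id)
  have len: "t = length u + length v" "length ?r = s - t"
    using u assms r by (auto dest: arg_cong[of _ _ length])
  have in_D: "u \<in> lists D" "?r \<in> lists D"
    using assms(1) w by (metis append_in_lists_conv)+
  have \<beta>: "pat (t - length v) u \<in> patterns n D"
    using assms r in_D len by (intro pat_in_patterns) auto
  have \<gamma>: "pat s ?r \<in> patterns n D"
    using assms r in_D len by (intro pat_in_patterns) auto
  have 1: "pat_concat (pat (t - length v) u) (pat t v) = pat t (u @ v)"
    using len by (intro pat_concat_pat) auto
  have t: "t = s - length ?r" using len r by auto
  have 2: "pat_concat (pat (s - length ?r) (u @ v)) (pat s ?r) = pat s ((u @ v) @ ?r)"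
    using len r by (intro pat_concat_pat) auto
  have "pat s w = pat_concat (pat_concat (pat (t - length v) u) (pat t v)) (pat s ?r)"
    unfolding 1 using 2 t w by metis
  moreover have "adjacent (pat (t - length v) u) (pat t v)"
    using assms by (simp add: adjacent_pat)
  moreover have "adjacent (pat t v) (pat s ?r)"
    using len r assms by (subst adjacent_pat) auto
  ultimately show ?l
    unfolding is_subpattern_def using \<beta> \<gamma> by blast
qed

text \<open>The arithmetic condition says that both patterns start at the same position; its
  additive form avoids truncated subtraction.\<close>

lemma is_prefix_pat:
  assumes "w \<in> lists D" "length w \<le> s" "s \<le> n" "length v \<le> t"
  shows "is_prefix n D (pat t v) (pat s w) \<longleftrightarrow> prefix v w \<and> s + length v = t + length w" (is "?l \<longleftrightarrow> ?r")
proof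
  assume ?l
  then obtain \<gamma> where *: "\<gamma> \<in> patterns n D" "adjacent (pat t v) \<gamma>" "pat s w = pat_concat (pat t v) \<gamma>"
    by (auto simp: is_prefix_def)
  obtain l r where \<gamma>: "\<gamma> = pat l r" "length r \<le> l" using *(1) by (auto elim: patternsE)
  then show ?r using * assms
    by (auto simp: adjacent_pat pat_concat_def pat_def pat_start_def pat_end_def word_def)
next
  assume r: ?r
  then obtain u where u: "w = v @ u" by (auto simp: prefix_def)
  have t: "t = s - length u" "length u \<le> s" using r u assms by auto
  have "pat_concat (pat t v) (pat s u) = pat s w"
    unfolding t u using assms u by (intro pat_concat_pat) auto
  moreover have "pat s u \<in> patterns n D" using assms u by (intro pat_in_patterns) auto
  moreover have "adjacent (pat t v) (pat s u)" using t by (simp add: adjacent_pat)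
  ultimately show ?l unfolding is_prefix_def by metis
qed

section \<open>Sampling and lower bounds for probability mass functions\<close>

text \<open>The element \<open>a\<close> of positive weight makes the total positive, so the guard
  in \<open>sample_prop\<close> holds and the quotients sum to 1.\<close>

lemma pmf_sample_prop:
  assumes "finite A" "\<And>a. a \<in> A \<Longrightarrow> 0 \<le> w a" "a \<in> A" "0 < w a"
  shows "pmf (sample_prop A w) (Some a) = w a / (\<Sum>b\<in>A. w b)"
proof -
  let ?S = "\<Sum>b\<in>A. w b"
  let ?q = "\<lambda>a. if a \<in> A then w a / ?S else 0"
  have S: "0 < ?S" using assms by (intro sum_pos2) auto
  have nonneg: "\<And>a. 0 \<le> ?q a" using assms S by auto
  have "(\<integral>\<^sup>+ a. ennreal (?q a) \<partial>count_space UNIV) = (\<Sum>a\<in>A. ennreal (?q a))"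
    using assms(1) by (intro nn_integral_count_space') auto
  also have "\<dots> = ennreal (\<Sum>a\<in>A. ?q a)"
    by (rule sum_ennreal) (rule nonneg)
  also have "(\<Sum>a\<in>A. ?q a) = 1"
    using S by (simp flip: sum_divide_distrib)
  finally have "pmf (embed_pmf ?q) a = ?q a"
    using nonneg by (intro pmf_embed_pmf) auto
  then show ?thesis
    using assms by (auto simp: sample_prop_def pmf_map_inj')
qed

text \<open>Further preimages of \<open>f x\<close> can only add mass.\<close>

lemma pmf_map_ge: "pmf p x \<le> pmf (map_pmf f p) (f x)"
proof -
  have "pmf p x = measure p {x}" by (simp add: measure_pmf_single)
  also have "\<dots> \<le> measure p (f -` {f x})" by (intro measure_pmf.finite_measure_mono) auto
  finally show ?thesis by (simp add: pmf_map)
qed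

text \<open>Keeps the single outcome \<open>x\<close> of the first stage; the rest of the mixture is
  non-negative.\<close>

lemma pmf_bind_ge: "pmf p x * pmf (f x) y \<le> pmf (bind_pmf p f) y"
proof -
  have "ennreal (pmf p x * pmf (f x) y)
      = (\<integral>\<^sup>+z. ennreal (pmf (f x) y) * indicator {x} z \<partial>measure_pmf p)"
    by (simp add: nn_integral_cmult emeasure_pmf_single ennreal_mult' mult.commute)
  also have "\<dots> \<le> (\<integral>\<^sup>+z. ennreal (pmf (f z) y) \<partial>measure_pmf p)"
    by (intro nn_integral_mono) (auto simp: indicator_def)
  also have "\<dots> = ennreal (pmf (bind_pmf p f) y)" by (simp add: ennreal_pmf_bind)
  finally show ?thesis by (simp add: ennreal_le_iff)
qed

section \<open>Reachability in Hasse diagrams\<close>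

text \<open>Induction on the rank of \<open>b\<close>: an element of maximal rank between
  \<open>a\<close> and \<open>b\<close>, other than \<open>b\<close>, is covered by \<open>b\<close>
  and is reached from \<open>a\<close> by the induction hypothesis.\<close>

lemma hasse_rtrancl:
  fixes r :: "'a \<Rightarrow> 'a \<Rightarrow> bool" and h :: "'a \<Rightarrow> nat"
  assumes rank: "\<And>x y. \<lbrakk>x \<in> A; y \<in> A; r x y; x \<noteq> y\<rbrakk> \<Longrightarrow> h x < h y"
    and trans: "\<And>x y z. \<lbrakk>x \<in> A; y \<in> A; z \<in> A; r x y; r y z\<rbrakk> \<Longrightarrow> r x z"
    and "a \<in> A" "b \<in> A" "r a b"
  defines "H \<equiv> {(x, y). x \<in> A \<and> y \<in> A \<and> (r x y \<and> x \<noteq> y) \<and>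
                  \<not> (\<exists>z\<in>A. (r x z \<and> x \<noteq> z) \<and> (r z y \<and> z \<noteq> y))}"
  shows "(a, b) \<in> H\<^sup>*"
  using \<open>b \<in> A\<close> \<open>r a b\<close>
proof (induction "h b" arbitrary: b rule: less_induct)
  case less
  show ?case
  proof (cases "a = b")
    case False
    let ?B = "\<lambda>z. z \<in> A \<and> r a z \<and> r z b \<and> z \<noteq> b"
    show ?thesis
    proof (cases "\<exists>z. ?B z \<and> z \<noteq> a")
      case False
      with less \<open>a \<noteq> b\<close> \<open>a \<in> A\<close> have "(a, b) \<in> H" by (auto simp: H_def)
      then show ?thesis by blast
    next
      case True
      then obtain z0 where z0: "?B z0" by blast
      have "\<forall>z. ?B z \<longrightarrow> h z < h b" using rank less.prems by blast
      from arg_max_nat_lemma[of ?B, OF z0 this] obtain z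
        where z: "?B z" and max: "\<And>y. ?B y \<Longrightarrow> h y \<le> h z" by blast
      have "(a, z) \<in> H\<^sup>*" using less.hyps[of z] rank z less.prems by blast
      \<comment> \<open>An element strictly between \<open>z\<close> and \<open>b\<close> would
        satisfy \<open>?B\<close> by transitivity and exceed the maximal rank.\<close>
      moreover have "(z, b) \<in> H"
        unfolding H_def using z less.prems max rank trans \<open>a \<in> A\<close> by clarify (meson leD)
      ultimately show ?thesis by (rule rtrancl_into_rtrancl)
    qed
  qed simp
qed

section \<open>The model on words\<close>

locale pattern_model =
  fixes n :: nat
    and D :: "'d set"
    and \<Gamma> :: "'d list set"
    and c :: "'d pattern \<Rightarrow> real"
  assumes finite_D: "finite D"
    and finite_\<Gamma>: "finite \<Gamma>"
    and \<Gamma>_lists: "\<Gamma> \<subseteq> lists D"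
    and \<Gamma>_nonempty: "[] \<notin> \<Gamma>"
    and letters: "(\<lambda>d. [d]) ` D \<subseteq> \<Gamma>"
    and c_pos: "\<alpha> \<in> Pi_circ n \<Gamma> \<Longrightarrow> c \<alpha> > 0"
begin

text \<open>The words of \<open>Pi_at n D \<Gamma> s\<close>. The inequality says that
  \<open>v\<close>, started where \<open>w\<close> starts, ends by position \<open>n\<close>;
  \<open>length w \<le> s\<close> keeps that start at least 1.\<close>

definition P :: "nat \<Rightarrow> 'd list set" where
  "P s = {w. (w = [] \<or> (\<exists>v\<in>\<Gamma>. prefix w v \<and> s + length v \<le> n + length w)) \<and> length w \<le> s \<and> s \<le> n}"

definition L :: "nat \<Rightarrow> 'd list set" where
  "L s = {w \<in> lists D. length w = s}"

definition gain :: "nat \<Rightarrow> 'd list \<Rightarrow> real" where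
  "gain s w = (\<Prod>u\<in>{u \<in> \<Gamma>. suffix u w}. c (pat s u))"

text \<open>The cost of a labeling, with its subpatterns grouped by end position
  \<open>t\<close>.\<close>

definition weight :: "nat \<Rightarrow> 'd list \<Rightarrow> real" where
  "weight s w = (\<Prod>t\<in>{1..s}. gain t (take t w))"

definition fibre :: "nat \<Rightarrow> 'd list \<Rightarrow> 'd list set" where
  "fibre s v = {w \<in> L s. longest (P s) w = v}"

definition mass :: "nat \<Rightarrow> 'd list \<Rightarrow> real" where
  "mass s v = (\<Sum>w\<in>fibre s v. weight s w)"

text \<open>Word form of \<open>\<Delta>\<close>, except that all proper extensions \<open>b\<close>
  of \<open>v\<close> are excluded and not only its children in the Hasse diagram.\<close>

definition succs :: "nat \<Rightarrow> 'd list \<Rightarrow> 'd list set" where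
  "succs s v = {u \<in> P s. suffix (butlast v) u \<and>
      (\<forall>b\<in>P (Suc s). strict_suffix v b \<longrightarrow> \<not> suffix (butlast b) u)}"

lemma P_Nil: "s \<le> n \<Longrightarrow> [] \<in> P s"
  by (simp add: P_def)

lemma P_length: "w \<in> P s \<Longrightarrow> length w \<le> s"
  and P_le_n: "w \<in> P s \<Longrightarrow> s \<le> n"
  by (auto simp: P_def)

lemma P_lists: "w \<in> P s \<Longrightarrow> w \<in> lists D"
  using \<Gamma>_lists by (auto simp: P_def prefix_def)

lemma finite_P: "finite (P s)"
proof (rule finite_subset)
  show "P s \<subseteq> {[]} \<union> (\<Union>v\<in>\<Gamma>. set (prefixes v))"
    by (auto simp: P_def)
qed (use finite_\<Gamma> in auto)

text \<open>Dropping a letter lowers the end position as well, so the start is unchanged and the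
  same \<open>v \<in> \<Gamma>\<close> still fits.\<close>

lemma P_butlast:
  assumes "w \<in> P (Suc s)"
  shows "butlast w \<in> P s"
proof (cases "w = []")
  case False
  with assms obtain v where v: "v \<in> \<Gamma>" "prefix w v" "Suc s + length v \<le> n + length w"
      "length w \<le> Suc s" "Suc s \<le> n" by (auto simp: P_def)
  moreover have "prefix (butlast w) v"
    using v(2) by (meson prefix_order.trans prefixeq_butlast)
  ultimately show ?thesis using False by (auto simp: P_def intro!: bexI[of _ v])
qed (use assms in \<open>auto simp: P_def\<close>)

lemma \<Gamma>_in_P: "\<lbrakk>w \<in> \<Gamma>; length w \<le> s; s \<le> n\<rbrakk> \<Longrightarrow> w \<in> P s"
  by (auto simp: P_def)

lemma finite_L: "finite (L s)"
  using finite_lists_length_eq[OF finite_D, of s] by (simp add: L_def lists_eq_set)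

lemma finite_fibre: "finite (fibre s v)"
  by (simp add: fibre_def finite_L)

lemma take_L: "\<lbrakk>w \<in> L n; s \<le> n\<rbrakk> \<Longrightarrow> take s w \<in> L s"
  by (auto simp: L_def dest: in_set_takeD)

text \<open>Single letters belong to \<open>\<Gamma>\<close>, so the last letter of \<open>w\<close>
  alone is already a candidate.\<close>

lemma longest_nonempty:
  assumes "w \<in> L (Suc s)" "Suc s \<le> n"
  shows "longest (P (Suc s)) w \<noteq> []"
proof -
  from assms obtain y a where w: "w = y @ [a]" "a \<in> D"
    by (cases w rule: rev_cases) (auto simp: L_def)
  have "[a] \<in> P (Suc s)" using letters w assms by (intro \<Gamma>_in_P) auto
  then have "suffix [a] (longest (P (Suc s)) w)"
    using w assms by (intro longest_greatest P_Nil) auto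
  then show ?thesis by auto
qed

section \<open>Pattern sets and costs in terms of words\<close>

lemma Pi_circ_eq: "Pi_circ n \<Gamma> = {pat t v | t v. v \<in> \<Gamma> \<and> length v \<le> t \<and> t \<le> n}"
proof (intro equalityI subsetI)
  fix \<alpha> assume "\<alpha> \<in> Pi_circ n \<Gamma>"
  then show "\<alpha> \<in> {pat t v | t v. v \<in> \<Gamma> \<and> length v \<le> t \<and> t \<le> n}"
    by (auto simp: Pi_circ_def pat_def)
next
  fix \<alpha> assume "\<alpha> \<in> {pat t v | t v. v \<in> \<Gamma> \<and> length v \<le> t \<and> t \<le> n}"
  then show "\<alpha> \<in> Pi_circ n \<Gamma>"
    by (auto simp: Pi_circ_def pat_def)
qed

lemma Pi_at_eq: "Pi_at n D \<Gamma> s = pat s ` P s"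
proof (intro equalityI subsetI)
  fix \<alpha> assume "\<alpha> \<in> Pi_at n D \<Gamma> s"
  then consider "\<alpha> = empty_pat s" "s \<le> n"
    | \<beta> where "\<alpha> \<in> patterns n D" "pat_end \<alpha> = s" "\<beta> \<in> Pi_circ n \<Gamma>" "is_prefix n D \<alpha> \<beta>"
    by (auto simp: Pi_at_def Pi_all_def empty_pat_eq)
  then show "\<alpha> \<in> pat s ` P s"
  proof cases
    case 1
    then show ?thesis by (auto simp: empty_pat_eq P_Nil)
  next
    case 2
    obtain w where w: "\<alpha> = pat s w" "s \<le> n" "length w \<le> s"
      using 2(1,2) by (auto elim!: patternsE)
    obtain t v where v: "\<beta> = pat t v" "v \<in> \<Gamma>" "length v \<le> t" "t \<le> n"
      using 2(3) by (auto simp: Pi_circ_eq)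
    have "prefix w v" "t + length w = s + length v"
      using 2(4) w v \<Gamma>_lists by (auto simp: is_prefix_pat subset_iff)
    then show ?thesis using w v by (auto simp: P_def intro!: bexI[of _ v])
  qed
next
  fix \<alpha> assume "\<alpha> \<in> pat s ` P s"
  then obtain w where w: "\<alpha> = pat s w" "w \<in> P s" by auto
  show "\<alpha> \<in> Pi_at n D \<Gamma> s"
  proof (cases "w = []")
    case True
    then show ?thesis using w P_le_n by (auto simp: Pi_at_def Pi_all_def empty_pat_eq)
  next
    case False
    with w obtain v where v: "v \<in> \<Gamma>" "prefix w v" "s + length v \<le> n + length w"
      by (auto simp: P_def)
    \<comment> \<open>End position of the full pattern \<open>v\<close> when it starts where
      \<open>w\<close> starts.\<close>
    define t where "t = s + length v - length w"
    have len: "length w \<le> s" "length w \<le> length v" "s \<le> n"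
      using P_length P_le_n w v prefix_length_le by auto
    have "pat t v \<in> Pi_circ n \<Gamma>" using v len by (auto simp: Pi_circ_eq t_def)
    moreover have "is_prefix n D (pat s w) (pat t v)"
      using v len \<Gamma>_lists by (subst is_prefix_pat) (auto simp: t_def)
    moreover have "pat s w \<in> patterns n D"
      using len w P_lists by (intro pat_in_patterns) auto
    ultimately show ?thesis using w by (auto simp: Pi_at_def Pi_all_def)
  qed
qed

lemma gain_pos:
  assumes "length w \<le> s" "s \<le> n"
  shows "gain s w > 0"
  unfolding gain_def
proof (rule prod_pos)
  fix u assume "u \<in> {u \<in> \<Gamma>. suffix u w}"
  then have "pat s u \<in> Pi_circ n \<Gamma>"
    using assms suffix_length_le[of u w] by (auto simp: Pi_circ_eq)
  then show "c (pat s u) > 0" by (rule c_pos)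
qed

lemma weight_pos: "s \<le> n \<Longrightarrow> weight s w > 0"
  unfolding weight_def by (intro prod_pos gain_pos) auto

text \<open>Every word of \<open>\<Gamma>\<close> that is a suffix of \<open>w\<close> lies in
  \<open>P s\<close>, hence is already a suffix of the longest one.\<close>

lemma gain_longest:
  assumes "length w = s" "s \<le> n"
  shows "gain s (longest (P s) w) = gain s w"
proof -
  have "suffix u (longest (P s) w) \<longleftrightarrow> suffix u w" if "u \<in> \<Gamma>" for u
    using longest_greatest[OF P_Nil, of s u w] suffix_longest[OF P_Nil, of s w] assms that
      \<Gamma>_in_P suffix_length_le suffix_order.trans by metis
  then show ?thesis unfolding gain_def by (metis (mono_tags, lifting))
qed

text \<open>Subpatterns correspond one to one to pairs of an end position \<open>t\<close> and a
  word of \<open>\<Gamma>\<close> that is a suffix of \<open>take t w\<close>.\<close>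

lemma cost_pat:
  assumes "w \<in> L s" "s \<le> n"
  shows "cost n D \<Gamma> c (pat s w) = weight s w"
proof -
  let ?I = "SIGMA t:{1..s}. {u \<in> \<Gamma>. suffix u (take t w)}"
  have w: "w \<in> lists D" "length w = s" using assms by (auto simp: L_def)
  have *: "{\<alpha> \<in> Pi_circ n \<Gamma>. is_subpattern n D \<alpha> (pat s w)} = (\<lambda>(t, u). pat t u) ` ?I"
  proof (intro equalityI subsetI)
    fix \<alpha> assume "\<alpha> \<in> {\<alpha> \<in> Pi_circ n \<Gamma>. is_subpattern n D \<alpha> (pat s w)}"
    then obtain t u where \<alpha>: "\<alpha> = pat t u" "u \<in> \<Gamma>" "length u \<le> t" "t \<le> n"
        "is_subpattern n D \<alpha> (pat s w)" by (auto simp: Pi_circ_eq)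
    then have "t \<le> s" "suffix u (take t w)"
      using w assms by (auto simp: is_subpattern_pat)
    \<comment> \<open>No non-empty word ends at position 0, so the index range may start at
      1.\<close>
    moreover have "t \<noteq> 0" using \<alpha> \<Gamma>_nonempty by (cases u) auto
    ultimately show "\<alpha> \<in> (\<lambda>(t, u). pat t u) ` ?I" using \<alpha> by (auto simp: image_iff)
  next
    fix \<alpha> assume "\<alpha> \<in> (\<lambda>(t, u). pat t u) ` ?I"
    then obtain t u where \<alpha>: "\<alpha> = pat t u" "t \<le> s" "u \<in> \<Gamma>" "suffix u (take t w)" by auto
    then have "length u \<le> t" using suffix_length_le[of u "take t w"] by auto
    then show "\<alpha> \<in> {\<alpha> \<in> Pi_circ n \<Gamma>. is_subpattern n D \<alpha> (pat s w)}"
      using \<alpha> w assms by (auto simp: Pi_circ_eq is_subpattern_pat)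
  qed
  have "cost n D \<Gamma> c (pat s w) = (\<Prod>(t, u)\<in>?I. c (pat t u))"
    unfolding cost_def * by (subst prod.reindex) (auto simp: inj_on_def case_prod_unfold)
  also have "\<dots> = weight s w"
    unfolding weight_def gain_def using finite_\<Gamma> by (intro prod.Sigma[symmetric]) auto
  finally show ?thesis .
qed

text \<open>By \<open>longest_eq_iff\<close>, excluding all proper extensions of \<open>v\<close> in
  \<open>P s\<close> makes \<open>v\<close> the longest suffix.\<close>

lemma X_excl_pat:
  assumes "v \<in> P s"
  shows "X_excl n D s (pat s v) (Pi_at n D \<Gamma> s) = pat s ` fibre s v"
proof -
  have s: "s \<le> n" using assms P_le_n by auto
  have "pat s w \<in> X_excl n D s (pat s v) (Pi_at n D \<Gamma> s) \<longleftrightarrow> w \<in> fibre s v" if "w \<in> L s" for w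
  proof -
    have "is_suffix n D (pat s u) (pat s w) \<longleftrightarrow> suffix u w" if "u \<in> P s" for u
      using that \<open>w \<in> L s\<close> s P_length by (subst is_suffix_pat) (auto simp: L_def)
    moreover have "is_proper_suffix n D (pat s v) (pat s u) \<longleftrightarrow> strict_suffix v u" if "u \<in> P s" for u
      using that assms s P_length P_lists by (subst is_proper_suffix_pat) auto
    moreover have "pat s w \<in> labelings D 1 s"
      using that by (auto simp: labelings_eq L_def)
    ultimately show ?thesis
      using assms that
      by (auto simp: X_excl_def X_def Pi_at_eq fibre_def longest_eq_iff[OF P_Nil[OF s]])
  qed
  moreover have "X_excl n D s (pat s v) (Pi_at n D \<Gamma> s) \<subseteq> pat s ` L s"
    by (auto simp: X_excl_def X_def labelings_eq L_def)
  moreover have "fibre s v \<subseteq> L s" by (auto simp: fibre_def)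
  ultimately show ?thesis by blast
qed

lemma M_pat:
  assumes "v \<in> P s"
  shows "M n D \<Gamma> c s (pat s v) = mass s v"
proof -
  have "M n D \<Gamma> c s (pat s v) = (\<Sum>w\<in>fibre s v. cost n D \<Gamma> c (pat s w))"
    unfolding M_def X_excl_pat[OF assms] by (simp add: sum.reindex inj_pat)
  also have "\<dots> = mass s v"
    unfolding mass_def using P_le_n[OF assms] by (intro sum.cong) (auto simp: fibre_def cost_pat)
  finally show ?thesis .
qed

section \<open>Subtrees of the Hasse diagram and the sets \<open>\<Delta>\<close>\<close>

lemma is_suffix_Pi_at:
  assumes "u \<in> P s" "v \<in> P s"
  shows "is_suffix n D (pat s u) (pat s v) \<longleftrightarrow> suffix u v"
  using assms P_length P_le_n P_lists by (subst is_suffix_pat) auto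

text \<open>The word length serves as rank, since it grows strictly along proper suffixes.\<close>

lemma hasse_reaches:
  assumes "u \<in> P s" "v \<in> P s" "suffix u v"
  shows "(pat s u, pat s v) \<in> (E n D (Pi_at n D \<Gamma> s))\<^sup>*"
  unfolding E_def suffix_less_def
proof (rule hasse_rtrancl[where h = "\<lambda>\<alpha>. length (word \<alpha>)"])
  fix x y assume "x \<in> Pi_at n D \<Gamma> s" "y \<in> Pi_at n D \<Gamma> s" "is_suffix n D x y" "x \<noteq> y"
  then show "length (word x) < length (word y)"
    by (auto simp: Pi_at_eq is_suffix_Pi_at strict_suffix_def intro!: suffix_length_less)
next
  fix x y z assume "x \<in> Pi_at n D \<Gamma> s" "y \<in> Pi_at n D \<Gamma> s" "z \<in> Pi_at n D \<Gamma> s"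
    "is_suffix n D x y" "is_suffix n D y z"
  then show "is_suffix n D x z"
    by (auto simp: Pi_at_eq is_suffix_Pi_at dest: suffix_order.trans)
qed (use assms in \<open>auto simp: Pi_at_eq is_suffix_Pi_at\<close>)

lemma hasse_sound:
  assumes "(pat s u, \<beta>) \<in> (E n D (Pi_at n D \<Gamma> s))\<^sup>*" "u \<in> P s"
  shows "\<exists>v\<in>P s. \<beta> = pat s v \<and> suffix u v"
  using assms
proof (induction rule: rtrancl_induct)
  case (step \<beta> \<gamma>)
  then show ?case
    by (auto simp: E_def suffix_less_def Pi_at_eq is_suffix_Pi_at dest: suffix_order.trans)
qed auto

lemma T_pat:
  assumes "u \<in> P s"
  shows "T n D \<Gamma> s (pat s u) = pat s ` {v \<in> P s. suffix u v}"
  using hasse_sound[of s u] hasse_reaches[of u s] assms unfolding T_def by blast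

text \<open>Every proper extension \<open>b\<close> of \<open>v\<close> lies above some child
  \<open>e\<close> of \<open>v\<close>, and the subtree at \<open>butlast b\<close> is contained in
  the one at \<open>butlast e\<close>. Removing the subtrees of the children therefore removes
  everything that \<open>succs\<close> excludes.\<close>

lemma \<Delta>_pat:
  assumes "v \<in> P (Suc s)" "v \<noteq> []"
  shows "\<Delta> n D \<Gamma> s (pat (Suc s) v) = pat s ` succs s v"
proof -
  let ?E = "E n D (Pi_at n D \<Gamma> (Suc s))"
  have T: "T n D \<Gamma> s (pat_minus (pat (Suc s) b)) = pat s ` {u \<in> P s. suffix (butlast b) u}"
    if "b \<in> P (Suc s)" "b \<noteq> []" for b
    using that P_length[OF that(1)] pat_minus_pat[of b s] T_pat[OF P_butlast[OF that(1)]] by simp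
  have E: "(\<exists>b. (pat (Suc s) v, pat (Suc s) b) \<in> ?E \<and> suffix (butlast b) u) \<longleftrightarrow>
      (\<exists>b\<in>P (Suc s). strict_suffix v b \<and> suffix (butlast b) u)" (is "?l \<longleftrightarrow> ?r") for u
  proof
    assume ?l
    then show ?r
      by (auto simp: E_def suffix_less_def Pi_at_eq is_suffix_Pi_at strict_suffix_def)
  next
    assume ?r
    then obtain b where b: "b \<in> P (Suc s)" "strict_suffix v b" "suffix (butlast b) u" by blast
    have "(pat (Suc s) v, pat (Suc s) b) \<in> ?E\<^sup>*"
      using assms b by (intro hasse_reaches) (auto simp: strict_suffix_def)
    \<comment> \<open>The first edge of a path from \<open>v\<close> to \<open>b\<close> leads to
      the required child.\<close>
    then obtain \<gamma> where \<gamma>: "(pat (Suc s) v, \<gamma>) \<in> ?E" "(\<gamma>, pat (Suc s) b) \<in> ?E\<^sup>*"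
      using b(2) by (auto elim: converse_rtranclE)
    then obtain e where e: "\<gamma> = pat (Suc s) e" "e \<in> P (Suc s)"
      by (auto simp: E_def Pi_at_eq)
    have "suffix v e"
      using \<gamma>(1) e assms by (auto simp: E_def suffix_less_def is_suffix_Pi_at)
    moreover have "suffix e b"
      using hasse_sound[of "Suc s" e "pat (Suc s) b"] \<gamma>(2) e by auto
    \<comment> \<open>\<open>e\<close> has the non-empty suffix \<open>v\<close>, so
      \<open>e\<close> and \<open>b\<close> share a last letter, and dropping it preserves the
      suffix order.\<close>
    ultimately have "suffix (butlast e) (butlast b)"
      using assms(2) by (cases e rule: rev_cases; cases b rule: rev_cases) auto
    then show ?l using b(3) e \<gamma> suffix_order.trans by blast
  qed
  have child: "\<exists>b\<in>P (Suc s). \<beta> = pat (Suc s) b \<and> b \<noteq> []" if "(pat (Suc s) v, \<beta>) \<in> ?E" for \<beta>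
    using that assms by (auto simp: E_def suffix_less_def Pi_at_eq is_suffix_Pi_at)
  have "(\<Union>\<beta>\<in>{\<beta>. (pat (Suc s) v, \<beta>) \<in> ?E}. T n D \<Gamma> s (pat_minus \<beta>))
      = pat s ` {u \<in> P s. \<exists>b. (pat (Suc s) v, pat (Suc s) b) \<in> ?E \<and> suffix (butlast b) u}"
    using child T by fastforce
  then show ?thesis
    unfolding \<Delta>_def Suc_eq_plus1[symmetric] T[OF assms] E succs_def
    by (simp only: image_set_diff[OF inj_pat, symmetric]) (rule arg_cong[where f = "image (pat s)"], blast)
qed

section \<open>The recursion for the masses\<close>

text \<open>Whether \<open>v\<close> is the longest suffix after appending \<open>last v\<close> to
  \<open>y\<close> depends only on the longest suffix of \<open>y\<close> in \<open>P s\<close>, and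
  the condition on the latter is membership in \<open>succs s v\<close>.\<close>

lemma fibre_Suc:
  assumes v: "v \<in> P (Suc s)" "v \<noteq> []"
  shows "fibre (Suc s) v = (\<lambda>y. y @ [last v]) ` (\<Union>u\<in>succs s v. fibre s u)"
proof -
  have s: "Suc s \<le> n" "s \<le> n" using P_le_n[OF v(1)] by auto
  have lastD: "last v \<in> D" using P_lists[OF v(1)] v(2) by auto
  note Nil = P_Nil[OF s(1)] P_Nil[OF s(2)]
  \<comment> \<open>The longest suffix of \<open>y\<close> can stand in for \<open>y\<close> because
    \<open>butlast b\<close> belongs to \<open>P s\<close>.\<close>
  have extend: "suffix b (y @ [last v]) \<longleftrightarrow> suffix (butlast b) (longest (P s) y)"
    if "b \<in> P (Suc s)" "suffix v b" for b y
  proof -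
    have "b \<noteq> []" "last b = last v" using that(2) v(2) by (auto simp: suffix_def)
    then have "suffix b (y @ [last v]) \<longleftrightarrow> suffix (butlast b) y"
      by (simp only: suffix_snoc_iff simp_thms)
    then show ?thesis
      using longest_greatest[OF Nil(2) P_butlast[OF that(1)]] suffix_longest[OF Nil(2)]
        suffix_order.trans by blast
  qed
  have key: "longest (P (Suc s)) (y @ [last v]) = v \<longleftrightarrow> longest (P s) y \<in> succs s v" for y
  proof -
    have "longest (P s) y \<in> P s" by (rule longest_in[OF Nil(2)])
    moreover have "suffix v (y @ [last v]) \<longleftrightarrow> suffix (butlast v) (longest (P s) y)"
      using v(1) by (rule extend) simp
    moreover have "(\<forall>b\<in>P (Suc s). strict_suffix v b \<longrightarrow> \<not> suffix b (y @ [last v])) \<longleftrightarrow>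
        (\<forall>b\<in>P (Suc s). strict_suffix v b \<longrightarrow> \<not> suffix (butlast b) (longest (P s) y))"
      using extend by (simp only: strict_suffix_def cong: ball_cong imp_cong)
    ultimately show ?thesis
      using v(1) by (simp only: longest_eq_iff[OF Nil(1)] succs_def mem_Collect_eq simp_thms)
  qed
  show ?thesis
  proof (intro equalityI subsetI)
    fix w assume "w \<in> fibre (Suc s) v"
    then have w: "w \<in> L (Suc s)" "longest (P (Suc s)) w = v" "suffix v w"
      using suffix_longest[OF Nil(1), of w] by (auto simp: fibre_def)
    obtain y a where y: "w = y @ [a]" using w by (cases w rule: rev_cases) (auto simp: L_def)
    have a: "a = last v" using w(3) unfolding y by (simp only: suffix_snoc_iff[OF v(2)])
    have "longest (P s) y \<in> succs s v" using w(2) unfolding y a key .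
    moreover have "y \<in> L s" using w(1) y by (auto simp: L_def)
    ultimately show "w \<in> (\<lambda>y. y @ [last v]) ` (\<Union>u\<in>succs s v. fibre s u)"
      unfolding y a fibre_def by blast
  next
    fix w assume "w \<in> (\<lambda>y. y @ [last v]) ` (\<Union>u\<in>succs s v. fibre s u)"
    then obtain y where y: "w = y @ [last v]" "y \<in> L s" "longest (P s) y \<in> succs s v"
      by (auto simp: fibre_def)
    have "longest (P (Suc s)) w = v" unfolding y(1) key by (rule y(3))
    moreover have "w \<in> L (Suc s)" using y(1,2) lastD by (auto simp: L_def)
    ultimately show "w \<in> fibre (Suc s) v" by (simp add: fibre_def)
  qed
qed

text \<open>All words of the fibre share the longest suffix \<open>v\<close>, so by
  \<open>gain_longest\<close> the last factor of their weights is constant; the rest is a sum over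
  disjoint fibres.\<close>

lemma mass_Suc:
  assumes v: "v \<in> P (Suc s)" "v \<noteq> []"
  shows "mass (Suc s) v = gain (Suc s) v * (\<Sum>u\<in>succs s v. mass s u)"
proof -
  have s: "Suc s \<le> n" using P_le_n[OF v(1)] .
  have fin: "finite (succs s v)" using finite_P by (simp add: succs_def)
  have disj: "\<forall>u\<in>succs s v. \<forall>u'\<in>succs s v. u \<noteq> u' \<longrightarrow> fibre s u \<inter> fibre s u' = {}"
    by (auto simp: fibre_def)
  have weight: "weight (Suc s) (y @ [last v]) = gain (Suc s) v * weight s y"
    if "y \<in> (\<Union>u\<in>succs s v. fibre s u)" for y
  proof -
    have y: "length y = s" using that by (auto simp: fibre_def L_def)
    have "y @ [last v] \<in> fibre (Suc s) v" using that fibre_Suc[OF v] by auto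
    then have "longest (P (Suc s)) (y @ [last v]) = v" by (simp add: fibre_def)
    with gain_longest[of "y @ [last v]" "Suc s"] y s
    have g: "gain (Suc s) (y @ [last v]) = gain (Suc s) v" by simp
    show ?thesis
      unfolding weight_def using y g by (simp add: prod.nat_ivl_Suc' mult.commute)
  qed
  have "mass (Suc s) v = (\<Sum>y\<in>(\<Union>u\<in>succs s v. fibre s u). weight (Suc s) (y @ [last v]))"
    unfolding mass_def fibre_Suc[OF v] by (subst sum.reindex) (auto simp: inj_on_def)
  also have "\<dots> = gain (Suc s) v * (\<Sum>y\<in>(\<Union>u\<in>succs s v. fibre s u). weight s y)"
    by (simp add: weight sum_distrib_left)
  also have "(\<Sum>y\<in>(\<Union>u\<in>succs s v. fibre s u). weight s y) = (\<Sum>u\<in>succs s v. mass s u)"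
    unfolding mass_def using fin disj finite_fibre by (intro sum.UNION_disjoint) auto
  finally show ?thesis .
qed

lemma mass_nonneg: "s \<le> n \<Longrightarrow> 0 \<le> mass s v"
  unfolding mass_def by (intro sum_nonneg less_imp_le[OF weight_pos])

lemma weight_le_mass:
  assumes "w \<in> L s" "s \<le> n"
  shows "weight s w \<le> mass s (longest (P s) w)"
  unfolding mass_def using assms
  by (intro member_le_sum less_imp_le[OF weight_pos] finite_fibre) (auto simp: fibre_def)

lemma mass_pos: "\<lbrakk>w \<in> L s; s \<le> n\<rbrakk> \<Longrightarrow> 0 < mass s (longest (P s) w)"
  using weight_le_mass weight_pos by (meson less_le_trans)

section \<open>Runs determined by labelings and their probabilities\<close>

text \<open>By \<open>fibre_Suc\<close> the prefix of length \<open>Suc s\<close> extends a word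
  whose longest suffix is a successor, and that word can only be the prefix of length
  \<open>s\<close>.\<close>

lemma longest_take_in_succs:
  assumes "w \<in> L n" "Suc s \<le> n"
  defines "u \<equiv> \<lambda>t. longest (P t) (take t w)"
  shows "u s \<in> succs s (u (Suc s))"
proof -
  have w: "take (Suc s) w \<in> L (Suc s)" using take_L[OF assms(1,2)] .
  have v: "u (Suc s) \<in> P (Suc s)" using assms(2) by (auto simp: u_def intro!: longest_in P_Nil)
  have v': "u (Suc s) \<noteq> []" using w assms(2) by (simp add: u_def longest_nonempty)
  have "take (Suc s) w \<in> fibre (Suc s) (u (Suc s))" using w by (simp add: fibre_def u_def)
  then obtain u' y where y: "u' \<in> succs s (u (Suc s))" "y \<in> fibre s u'"
      "take (Suc s) w = y @ [last (u (Suc s))]"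
    unfolding fibre_Suc[OF v v'] by blast
  have "take s w = take s (take (Suc s) w)" by simp
  also have "\<dots> = y" unfolding y(3) using y(2) by (simp add: fibre_def L_def)
  finally have "u' = u s" using y(2) by (simp add: fibre_def u_def)
  then show ?thesis using y(1) by simp
qed

text \<open>The state of the run for \<open>w\<close> once step \<open>s\<close> is done; steps go
  downwards, so entries below \<open>s\<close> are still undefined.\<close>

definition path :: "nat \<Rightarrow> 'd list \<Rightarrow> nat \<rightharpoonup> 'd pattern" where
  "path s w = (\<lambda>t. if s \<le> t \<and> t \<le> n then Some (pat t (longest (P t) (take t w))) else None)"

lemma partition_function_eq: "partition_function n D \<Gamma> c = (\<Sum>w\<in>L n. weight n w)"
proof -
  have "labelings D 1 n = pat n ` L n" by (simp add: labelings_eq L_def)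
  then show ?thesis
    by (simp add: partition_function_def sum.reindex inj_pat cost_pat)
qed

text \<open>The fibres partition the labelings. This identifies the normalizer of the first
  sample.\<close>

lemma sum_mass: "(\<Sum>v\<in>P n. mass n v) = partition_function n D \<Gamma> c"
proof -
  have "L n = (\<Union>v\<in>P n. fibre n v)"
    using longest_in[OF P_Nil, of n] by (auto simp: fibre_def)
  then have "partition_function n D \<Gamma> c = (\<Sum>w\<in>(\<Union>v\<in>P n. fibre n v). weight n w)"
    by (simp only: partition_function_eq)
  also have "\<dots> = (\<Sum>v\<in>P n. mass n v)"
    unfolding mass_def using finite_P finite_fibre
    by (intro sum.UNION_disjoint ballI impI) (auto simp: fibre_def)
  finally show ?thesis by simp
qed

lemma pmf_sample_M:
  assumes "A \<subseteq> P s" "u \<in> A" "0 < mass s u"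
  shows "pmf (sample_prop (pat s ` A) (M n D \<Gamma> c s)) (Some (pat s u)) = mass s u / (\<Sum>v\<in>A. mass s v)"
proof -
  have M: "M n D \<Gamma> c s (pat s v) = mass s v" if "v \<in> A" for v
    using that assms(1) M_pat by auto
  have "s \<le> n" using assms P_le_n by auto
  then have "pmf (sample_prop (pat s ` A) (M n D \<Gamma> c s)) (Some (pat s u))
      = M n D \<Gamma> c s (pat s u) / (\<Sum>\<beta>\<in>pat s ` A. M n D \<Gamma> c s \<beta>)"
    using assms finite_subset[OF assms(1) finite_P]
    by (intro pmf_sample_prop) (auto simp: M mass_nonneg)
  then show ?thesis using assms by (simp add: sum.reindex inj_pat M)
qed

text \<open>The mass at \<open>s\<close> counts what is still undecided, and the gains are those of
  the positions already passed. Going down from \<open>n\<close>, where the product is empty, the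
  normalizers cancel one after the other.\<close>

lemma pmf_run_from_ge:
  assumes w: "w \<in> L n" and "s \<le> n"
  defines "init \<equiv> map_pmf (\<lambda>r. Map.empty(n := r)) (sample_prop (Pi_at n D \<Gamma> n) (M n D \<Gamma> c n))"
  shows "mass s (longest (P s) (take s w)) * (\<Prod>t\<in>{s<..n}. gain t (take t w)) / partition_function n D \<Gamma> c
    \<le> pmf (fold (\<lambda>s p. bind_pmf p (sample_step n D \<Gamma> c s)) (rev [s..<n]) init) (path s w)"
    (is "?bound s \<le> pmf (?run s) _")
  using \<open>s \<le> n\<close>
proof (induction rule: inc_induct)
  case base
  have take_n: "take n w = w" using w by (simp add: L_def)
  have "longest (P n) w \<in> P n" by (auto intro!: longest_in P_Nil)
  then have "mass n (longest (P n) w) / partition_function n D \<Gamma> c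
      = pmf (sample_prop (Pi_at n D \<Gamma> n) (M n D \<Gamma> c n)) (Some (pat n (longest (P n) w)))"
    using w by (simp add: Pi_at_eq pmf_sample_M mass_pos flip: sum_mass)
  also have "\<dots> \<le> pmf init (Map.empty(n := Some (pat n (longest (P n) w))))"
    unfolding init_def by (rule pmf_map_ge)
  also have "Map.empty(n := Some (pat n (longest (P n) w))) = path n w"
    using take_n by (auto simp: path_def fun_eq_iff)
  finally show ?case by (simp add: take_n)
next
  case (step s)
  let ?u = "longest (P s) (take s w)" and ?v = "longest (P (Suc s)) (take (Suc s) w)"
  have s: "Suc s \<le> n" "s \<le> n" using step by auto
  have v: "?v \<in> P (Suc s)" "?v \<noteq> []"
    using s w by (auto intro!: longest_in P_Nil simp: longest_nonempty take_L)
  have u: "?u \<in> succs s ?v" using longest_take_in_succs[OF w s(1)] .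
  have m: "0 < mass s ?u" using mass_pos take_L[OF w] s by auto
  let ?S = "\<Sum>u\<in>succs s ?v. mass s u"
  have "0 < ?S"
    using u m s finite_P by (intro sum_pos2[of _ ?u]) (auto simp: mass_nonneg succs_def)
  have "gain (Suc s) ?v = gain (Suc s) (take (Suc s) w)"
    using s w by (intro gain_longest) (auto simp: L_def)
  moreover have "{s<..n} = insert (Suc s) {Suc s<..n}" using s by auto
  \<comment> \<open>By \<open>mass_Suc\<close> the mass at \<open>Suc s\<close> is the gain there
    times \<open>?S\<close>, so \<open>?S\<close> cancels and the gain joins the product.\<close>
  ultimately have "?bound s = ?bound (Suc s) * (mass s ?u / ?S)"
    using \<open>0 < ?S\<close> by (simp add: mass_Suc[OF v])
  also have "\<dots> \<le> pmf (?run (Suc s)) (path (Suc s) w) * (mass s ?u / ?S)"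
    using step.IH \<open>0 < ?S\<close> m by (intro mult_right_mono) auto
  also have "mass s ?u / ?S = pmf (sample_prop (\<Delta> n D \<Gamma> s (pat (Suc s) ?v)) (M n D \<Gamma> c s)) (Some (pat s ?u))"
    unfolding \<Delta>_pat[OF v] using u m by (intro pmf_sample_M[symmetric]) (auto simp: succs_def)
  also have "\<dots> \<le> pmf (map_pmf (\<lambda>r. (path (Suc s) w)(s := r))
      (sample_prop (\<Delta> n D \<Gamma> s (pat (Suc s) ?v)) (M n D \<Gamma> c s))) ((path (Suc s) w)(s := Some (pat s ?u)))"
    by (rule pmf_map_ge)
  also have "(path (Suc s) w)(s := Some (pat s ?u)) = path s w"
    using s by (auto simp: path_def)
  also have "map_pmf (\<lambda>r. (path (Suc s) w)(s := r))
      (sample_prop (\<Delta> n D \<Gamma> s (pat (Suc s) ?v)) (M n D \<Gamma> c s)) = sample_step n D \<Gamma> c s (path (Suc s) w)"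
    using s v(2) by (simp add: sample_step_def path_def empty_pat_eq)
  also have "pmf (?run (Suc s)) (path (Suc s) w) * pmf (sample_step n D \<Gamma> c s (path (Suc s) w)) (path s w)
      \<le> pmf (bind_pmf (?run (Suc s)) (sample_step n D \<Gamma> c s)) (path s w)"
    by (rule pmf_bind_ge)
  \<comment> \<open>\<open>rev [s..<n]\<close> ends in \<open>s\<close>, so step \<open>s\<close> is
    the outermost bind.\<close>
  also have "bind_pmf (?run (Suc s)) (sample_step n D \<Gamma> c s) = ?run s"
    using step by (simp add: upt_conv_Cons)
  finally show ?case by (simp add: mult_left_mono)
qed

text \<open>The case \<open>s = 1\<close> of the previous bound: estimating \<open>mass 1\<close> by
  the weight of the first letter completes the product of gains.\<close>

lemma pmf_run_ge:
  assumes w: "w \<in> L n" and "1 \<le> n"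
  shows "weight n w / partition_function n D \<Gamma> c \<le> pmf (run n D \<Gamma> c) (path 1 w)"
proof -
  let ?R = "\<Prod>t\<in>{1<..n}. gain t (take t w)"
  have "{1..n} = insert 1 {1<..n}" using \<open>1 \<le> n\<close> by auto
  then have "weight n w = weight 1 (take 1 w) * ?R" by (simp add: weight_def)
  also have "\<dots> \<le> mass 1 (longest (P 1) (take 1 w)) * ?R"
    using assms by (intro mult_right_mono weight_le_mass take_L prod_nonneg less_imp_le[OF gain_pos]) auto
  finally have "weight n w / partition_function n D \<Gamma> c
      \<le> mass 1 (longest (P 1) (take 1 w)) * ?R / partition_function n D \<Gamma> c"
    by (intro divide_right_mono) (auto simp: partition_function_eq intro!: sum_nonneg less_imp_le[OF weight_pos])
  also have "\<dots> \<le> pmf (run n D \<Gamma> c) (path 1 w)"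
    unfolding run_def using assms by (rule pmf_run_from_ge)
  finally show ?thesis .
qed

section \<open>Reading off the labeling, and validity of the steps\<close>

text \<open>The longest suffix of \<open>take s w\<close> is non-empty and hence ends in the letter
  of \<open>w\<close> at position \<open>s\<close>.\<close>

lemma labeling_of_path:
  assumes w: "w \<in> L n"
  shows "labeling_of n (path 1 w) = Some (pat n w)"
proof -
  \<comment> \<open>Positions count from 1 and list indices from 0, hence
    \<open>s - 1\<close>.\<close>
  have *: "longest (P s) (take s w) \<noteq> [] \<and>
      word (pat_restrict s s (pat s (longest (P s) (take s w)))) = [w ! (s - 1)]"
    if s: "s \<in> {1..n}" for s
  proof -
    obtain k where k: "s = Suc k" using s by (cases s) auto
    let ?v = "longest (P s) (take s w)"
    have v: "?v \<noteq> []" "suffix ?v (take s w)" "length ?v \<le> s"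
      using s w unfolding k
      by (auto intro!: suffix_longest P_Nil P_length longest_in simp: longest_nonempty take_L)
    have "take s w = take k w @ [w ! k]"
      using w s k by (auto simp: L_def take_Suc_conv_app_nth)
    with v(1,2) have "last ?v = w ! k" by (metis suffix_snoc_iff)
    moreover obtain y a where "?v = y @ [a]" using v(1) by (cases ?v rule: rev_cases) auto
    ultimately show ?thesis
      using v k by (simp add: pat_restrict_def word_def pat_def pat_start_def)
  qed
  have "map (\<lambda>s. word (pat_restrict s s (the (path 1 w s)))) [1..<n + 1] = map (\<lambda>s. [w ! (s - 1)]) [1..<n + 1]"
    using * by (intro map_cong) (auto simp: path_def)
  also have "\<dots> = map (\<lambda>i. [w ! i]) [0..<n]"
    by (simp add: map_Suc_upt[symmetric] del: upt_Suc)
  also have "concat \<dots> = w"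
    using w map_nth[of w] by (auto simp: L_def)
  finally have "concat (map (\<lambda>s. word (pat_restrict s s (the (path 1 w s)))) [1..<n + 1]) = w" .
  moreover have "\<forall>s\<in>{1..n}. \<exists>\<alpha>. path 1 w s = Some \<alpha> \<and> \<alpha> \<noteq> empty_pat s"
    using * by (auto simp: path_def empty_pat_eq)
  moreover have "((1, n), w) = pat n w" using w by (simp add: pat_def L_def)
  ultimately show ?thesis unfolding labeling_of_def by simp
qed

text \<open>The pattern of the path at \<open>s\<close> is itself a witness: its fibre contains
  \<open>take s w\<close>, so its mass is positive.\<close>

lemma valid_step_path:
  assumes w: "w \<in> L n" and "s \<le> n" "1 \<le> s"
  shows "valid_step n D \<Gamma> c (path 1 w) s"
  using assms(2,3)
proof (induction rule: inc_induct)
  case base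
  show ?case by (rule valid_step.last)
next
  case (step s)
  let ?u = "longest (P s) (take s w)" and ?v = "longest (P (Suc s)) (take (Suc s) w)"
  have s: "Suc s \<le> n" "s \<le> n" using step by auto
  have v: "?v \<in> P (Suc s)" "?v \<noteq> []"
    using s w by (auto intro!: longest_in P_Nil simp: longest_nonempty take_L)
  have "?u \<in> succs s ?v" using longest_take_in_succs[OF w s(1)] .
  moreover have "?u \<in> P s" using s by (auto intro!: longest_in P_Nil)
  then have "M n D \<Gamma> c s (pat s ?u) > 0"
    using s w by (simp add: M_pat mass_pos take_L)
  ultimately have ex: "\<exists>\<beta>\<in>\<Delta> n D \<Gamma> s (pat (Suc s) ?v). M n D \<Gamma> c s \<beta> > 0"
    by (auto simp: \<Delta>_pat[OF v])
  show ?case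
    by (rule valid_step.step[where \<alpha> = "pat (Suc s) ?v"])
      (use step s v ex in \<open>auto simp: path_def empty_pat_eq\<close>)
qed

end

section \<open>Lower bounds summing to 1, and the resulting distribution\<close>

theorem theorem3:
  fixes n :: nat
    and D :: "'d set"
    and \<Gamma> :: "'d list set"
    and c :: "'d pattern \<Rightarrow> real"
  assumes "n \<ge> 1"
    and "finite D" and "D \<noteq> {}"
    and "finite \<Gamma>" and "\<Gamma> \<subseteq> lists D" and "[] \<notin> \<Gamma>"
    and "(\<lambda>d. [d]) ` D \<subseteq> \<Gamma>"
    and "\<forall>\<alpha>\<in>Pi_circ n \<Gamma>. c \<alpha> > 0"
  shows "(AE a in measure_pmf (run n D \<Gamma> c). \<forall>s\<in>{1..n}. valid_step n D \<Gamma> c a s) \<and>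
    (\<forall>x\<in>labelings D 1 n.
       pmf (returned n D \<Gamma> c) (Some x) = cost n D \<Gamma> c x / partition_function n D \<Gamma> c)"
proof -
  interpret pattern_model n D \<Gamma> c
    using assms by unfold_locales auto
  let ?Z = "partition_function n D \<Gamma> c" and ?r = "run n D \<Gamma> c"
  \<comment> \<open>A constant labeling shows that the sum defining \<open>?Z\<close> is not
    empty.\<close>
  obtain d where "d \<in> D" using \<open>D \<noteq> {}\<close> by auto
  then have "replicate n d \<in> L n" by (auto simp: L_def)
  then have "0 < ?Z"
    unfolding partition_function_eq
    by (intro sum_pos2[of _ "replicate n d"] finite_L weight_pos less_imp_le[OF weight_pos]) auto
  then have total: "(\<Sum>w\<in>L n. weight n w / ?Z) = 1"
    by (simp add: partition_function_eq flip: sum_divide_distrib)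
  \<comment> \<open>\<open>labeling_of\<close> recovers \<open>w\<close> from its path.\<close>
  have inj: "inj_on (path 1) (L n)"
    by (rule inj_onI) (metis labeling_of_path option.inject pat_eq_iff)
  have runs: "(\<Sum>w\<in>L n. pmf ?r (path 1 w)) = measure ?r (path 1 ` L n)"
    using inj finite_L by (simp add: measure_measure_pmf_finite sum.reindex)
  then have "(\<Sum>w\<in>L n. pmf ?r (path 1 w)) \<le> 1" by simp
  moreover have le: "weight n w / ?Z \<le> pmf ?r (path 1 w)" if "w \<in> L n" for w
    using pmf_run_ge that \<open>n \<ge> 1\<close> by auto
  \<comment> \<open>The lower bounds sum to 1 and the probabilities to at most 1, so each bound is
    attained.\<close>
  ultimately have pmf_path: "pmf ?r (path 1 w) = weight n w / ?Z" if "w \<in> L n" for w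
    using sum_mono_inv[of "\<lambda>w. weight n w / ?Z" "L n" "\<lambda>w. pmf ?r (path 1 w)" w]
      sum_mono[of "L n" "\<lambda>w. weight n w / ?Z" "\<lambda>w. pmf ?r (path 1 w)"] total that finite_L by force
  have "measure ?r (path 1 ` L n) = 1" using runs total pmf_path by simp
  then have AE: "AE a in ?r. a \<in> path 1 ` L n"
    by (subst measure_pmf.AE_in_set_eq_1) auto
  have "pmf (returned n D \<Gamma> c) (Some x) = cost n D \<Gamma> c x / ?Z" if x: "x \<in> labelings D 1 n" for x
  proof -
    obtain w where w: "x = pat n w" "w \<in> L n" using x by (auto simp: labelings_eq L_def)
    \<comment> \<open>Among paths only that of \<open>w\<close> returns \<open>x\<close>; all other
      runs form a null set.\<close>
    have *: "labeling_of n a = Some x \<longleftrightarrow> a = path 1 w" if "a \<in> path 1 ` L n" for a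
      using that w by (metis imageE labeling_of_path option.inject pat_eq_iff)
    have "pmf (returned n D \<Gamma> c) (Some x) = measure ?r (labeling_of n -` {Some x})"
      by (simp add: returned_def pmf_map)
    also have "\<dots> = measure ?r {path 1 w}"
      by (rule measure_pmf.finite_measure_eq_AE)
        (use AE * in \<open>auto elim!: eventually_mono\<close>)
    finally show ?thesis using w by (simp add: measure_pmf_single pmf_path cost_pat del: One_nat_def)
  qed
  moreover have "AE a in ?r. \<forall>s\<in>{1..n}. valid_step n D \<Gamma> c a s"
    using AE by eventually_elim (auto intro: valid_step_path simp del: One_nat_def)
  ultimately show ?thesis by blast
qed

end
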